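(* Let $n\ge 1$ and $0\le k\le n$. The cyclic $(n,k)$-matrix $M_{n,k}$ is $k$-uniform and optimal (i.e. the cyclic scheme $S_{n,k}$ is optimal).
   Context: Indices run from $0$ to $n-1$. The cyclic $(n,k)$-matrix $M_{n,k}=(m_{i,j})_{0\le i,j\le n-1}$ has $m_{i,j}=1$ iff $j\equiv ik+a \pmod n$ for some $0\le a\le k-1$, and $m_{i,j}=0$ otherwise (traveller $t_i$ cycles the $k$ cyclically consecutive stages from post $P_{ik}$ to $P_{(i+1)k}$, indices mod $n$). Biker–hiker model: $n$ travellers $t_0,\dots,t_{n-1}$; posts $P_0,\dots,P_n$ at unit spacing; stage $s_j$ is the leg from $P_j$ to $P_{j+1}$ ($0\le j\le n-1$). All start at $P_0$ at time $0$, walk at common speed $w$, cycle at common speed $v>w$, mode changes take no time. An $n\times n$ binary matrix $M$ prescribes that $t_i$ cycles $s_j$ iff $m_{i,j}=1$. $M$ is $k$-uniform if every row and every column has exactly $k$ ones. Bicycles start at $P_0$, move only when ridden by one rider, and a traveller due to cycle $s_j$ must take a bicycle present at $P_j$ when he arrives there. $M$ is optimal if it is $k$-uniform for some $k$ and, with $k$ bicycles, the scheme can be executed with no traveller ever having to wait for a bicycle. *)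

theory Defs
  imports
    Complex_Main
    "HOL-Number_Theory.Cong"
    "Jordan_Normal_Form.Matrix"
begin

definition cyclic_matrix :: "nat \<Rightarrow> nat \<Rightarrow> nat mat" where
  "cyclic_matrix n k = mat n n (\<lambda>(i, j). if \<exists>a<k. [j = i * k + a] (mod n) then 1 else 0)"

definition k_uniform :: "nat \<Rightarrow> nat \<Rightarrow> nat mat \<Rightarrow> bool" where
  "k_uniform n k M \<longleftrightarrow>
     M \<in> carrier_mat n n \<and>
     (\<forall>i<n. \<forall>j<n. M $$ (i, j) \<in> {0, 1}) \<and>
     (\<forall>i<n. card {j. j < n \<and> M $$ (i, j) = 1} = k) \<and>
     (\<forall>j<n. card {i. i < n \<and> M $$ (i, j) = 1} = k)"

text \<open>
  Traveller \<open>i\<close> leaves post \<open>j\<close> at time \<open>dep i j\<close>. Stages have unit length, \<open>w\<close> is the walking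
  and \<open>v\<close> the cycling speed, and everybody is at post \<open>0\<close> at time \<open>0\<close>.
\<close>

definition stage_time :: "real \<Rightarrow> real \<Rightarrow> nat mat \<Rightarrow> nat \<Rightarrow> nat \<Rightarrow> real" where
  "stage_time w v M i j = (if M $$ (i, j) = 1 then 1 / v else 1 / w)"

definition arrival ::
  "real \<Rightarrow> real \<Rightarrow> nat mat \<Rightarrow> (nat \<Rightarrow> nat \<Rightarrow> real) \<Rightarrow> nat \<Rightarrow> nat \<Rightarrow> real" where
  "arrival w v M dep i j =
     (case j of 0 \<Rightarrow> 0 | Suc l \<Rightarrow> dep i l + stage_time w v M i l)"

text \<open>
  \<open>bike i j\<close> is the bicycle that traveller \<open>i\<close> uses on stage \<open>j\<close> (relevant only if he cycles that
  stage). Being on the move is taken over the half-open period from departure to arrival, so that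
  a bicycle may be taken over at the very instant at which it is brought to a post.
\<close>

definition riding ::
  "real \<Rightarrow> nat \<Rightarrow> nat mat \<Rightarrow> (nat \<Rightarrow> nat \<Rightarrow> real) \<Rightarrow> (nat \<Rightarrow> nat \<Rightarrow> nat)
    \<Rightarrow> nat \<Rightarrow> nat \<Rightarrow> nat \<Rightarrow> real \<Rightarrow> bool" where
  "riding v n M dep bike i j c t \<longleftrightarrow>
     i < n \<and> j < n \<and> M $$ (i, j) = 1 \<and> bike i j = c \<and>
     dep i j \<le> t \<and> t < dep i j + 1 / v"

text \<open>
  \<open>loc c t\<close> is the distance of bicycle \<open>c\<close> from post \<open>0\<close> at time \<open>t\<close>. The last two conditions fix
  the motion of the bicycles; at \<open>t = dep i j\<close> the first of these two says that the bicycle to be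
  taken is present at post \<open>j\<close>. Only a traveller about to cycle may leave a post later than he
  arrives there.
\<close>

definition execution ::
  "real \<Rightarrow> real \<Rightarrow> nat \<Rightarrow> nat \<Rightarrow> nat mat \<Rightarrow> (nat \<Rightarrow> nat \<Rightarrow> real) \<Rightarrow> (nat \<Rightarrow> nat \<Rightarrow> nat)
    \<Rightarrow> (nat \<Rightarrow> real \<Rightarrow> real) \<Rightarrow> bool" where
  "execution w v n k M dep bike loc \<longleftrightarrow>
     (\<forall>i<n. \<forall>j<n. M $$ (i, j) = 0 \<longrightarrow> dep i j = arrival w v M dep i j) \<and>
     (\<forall>i<n. \<forall>j<n. M $$ (i, j) = 1 \<longrightarrow> dep i j \<ge> arrival w v M dep i j \<and> bike i j < k) \<and>
     (\<forall>c<k. loc c 0 = 0) \<and>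
     (\<forall>c<k. \<forall>t i j i' j'. riding v n M dep bike i j c t \<and> riding v n M dep bike i' j' c t
        \<longrightarrow> i = i' \<and> j = j') \<and>
     (\<forall>i<n. \<forall>j<n. M $$ (i, j) = 1 \<longrightarrow>
        (\<forall>t\<in>{dep i j..dep i j + 1 / v}. loc (bike i j) t = real j + v * (t - dep i j))) \<and>
     (\<forall>c<k. \<forall>t1 t2. 0 \<le> t1 \<and> t1 \<le> t2 \<and>
        (\<forall>t\<in>{t1..<t2}. \<forall>i j. \<not> riding v n M dep bike i j c t) \<longrightarrow> loc c t2 = loc c t1)"

definition no_waiting ::
  "real \<Rightarrow> real \<Rightarrow> nat \<Rightarrow> nat mat \<Rightarrow> (nat \<Rightarrow> nat \<Rightarrow> real) \<Rightarrow> bool" where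
  "no_waiting w v n M dep \<longleftrightarrow> (\<forall>i<n. \<forall>j<n. dep i j = arrival w v M dep i j)"

definition optimal :: "real \<Rightarrow> real \<Rightarrow> nat \<Rightarrow> nat mat \<Rightarrow> bool" where
  "optimal w v n M \<longleftrightarrow>
     (\<exists>k. k_uniform n k M \<and>
        (\<exists>dep bike loc. execution w v n k M dep bike loc \<and> no_waiting w v n M dep))"

end

theory Submission
  imports Defs
begin

text \<open>
  List the ones of the cyclic matrix as positions \<open>p < n * k\<close>, where position \<open>p\<close> lies in row
  \<open>p div k\<close> and column \<open>p mod n\<close>. Bicycle \<open>m\<close> is given the positions \<open>m * n + j\<close> with \<open>j < n\<close>, so it
  is ridden on stage \<open>j\<close> by traveller \<open>(j + m * n) div k\<close>. It changes hands at post \<open>j\<close> only if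
  \<open>j + m * n\<close> is a multiple of \<open>k\<close>; then the rider handing it over has just cycled the last
  \<open>min j k\<close> stages, which is as much as anybody can have cycled before post \<open>j\<close>, so no traveller
  reaches post \<open>j\<close> before him and nobody waits.
\<close>

text \<open>Matrix entries are natural numbers: this keeps the simplifier from turning
  \<open>= 1\<close> into \<open>= Suc 0\<close>.\<close>

declare One_nat_def [simp del]

section \<open>Positions of the ones, and uniformity\<close>

definition rider :: "nat \<Rightarrow> nat \<Rightarrow> nat \<Rightarrow> nat \<Rightarrow> nat" where
  "rider n k j m = (j + m * n) div k"

lemma rider_less:
  assumes "j < n" "m < k"
  shows "rider n k j m < n"
proof -
  have "j + m * n < Suc m * n" using assms by simp
  also have "\<dots> \<le> k * n" using assms by (intro mult_right_mono) auto
  finally show ?thesis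
    unfolding rider_def by (simp add: less_mult_imp_div_less mult.commute)
qed

lemma cyclic_matrix_carrier: "cyclic_matrix n k \<in> carrier_mat n n"
  by (simp add: cyclic_matrix_def)

lemma cyclic_matrix_eq_1_iff:
  assumes "i < n" "j < n"
  shows "cyclic_matrix n k $$ (i, j) = 1 \<longleftrightarrow> (\<exists>a<k. j = (i * k + a) mod n)"
  using assms by (auto simp: cyclic_matrix_def cong_def)

text \<open>A position has two forms \<open>i * k + a = j + m * n\<close>. Division by
  \<open>k\<close> yields row and offset, division by \<open>n\<close> yields bicycle and
  column.\<close>

lemma cyclic_matrix_eq_1_iff_rider:
  assumes "i < n" "j < n"
  shows "cyclic_matrix n k $$ (i, j) = 1 \<longleftrightarrow> (\<exists>m<k. rider n k j m = i)"
proof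
  assume "cyclic_matrix n k $$ (i, j) = 1"
  then obtain a where a: "a < k" "j = (i * k + a) mod n"
    using cyclic_matrix_eq_1_iff[OF assms] by blast
  define m where "m = (i * k + a) div n"
  have p: "j + m * n = i * k + a" using a by (simp add: m_def)
  have "i * k + a < Suc i * k" using a by simp
  also have "\<dots> \<le> n * k" using assms by (intro mult_right_mono) auto
  finally have "m < k" unfolding m_def by (simp add: less_mult_imp_div_less mult.commute)
  moreover have "rider n k j m = i" using a(1) unfolding rider_def p by simp
  ultimately show "\<exists>m<k. rider n k j m = i" by blast
next
  assume "\<exists>m<k. rider n k j m = i"
  then obtain m where m: "m < k" "rider n k j m = i" by blast
  define a where "a = (j + m * n) mod k"
  have "i * k + a = j + m * n"
    using m(2) unfolding rider_def a_def by (metis div_mult_mod_eq)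
  moreover have "a < k" using m by (simp add: a_def)
  ultimately show "cyclic_matrix n k $$ (i, j) = 1"
    using cyclic_matrix_eq_1_iff[OF assms] assms by (metis mod_less mod_mult_self1)
qed

text \<open>Successive positions in a column differ by \<open>n\<close>, which is at least
  \<open>k\<close>, so their quotients by \<open>k\<close> strictly increase.\<close>

lemma inj_on_rider:
  assumes "k \<le> n"
  shows "inj_on (rider n k j) {..<k}"
proof (rule linorder_inj_onI')
  fix m m' assume *: "m \<in> {..<k}" "m' \<in> {..<k}" "m < m'"
  have "j + m * n + k \<le> j + Suc m * n" using assms by simp
  also have "\<dots> \<le> j + m' * n" using * by (intro add_left_mono mult_right_mono) auto
  finally have "(j + m * n + k) div k \<le> (j + m' * n) div k" by (rule div_le_mono)
  then show "rider n k j m \<noteq> rider n k j m'" using * by (simp add: rider_def)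
qed

lemma card_cyclic_matrix_row:
  assumes "i < n" "k \<le> n"
  shows "card {j. j < n \<and> cyclic_matrix n k $$ (i, j) = 1} = k"
proof -
  have "inj_on (\<lambda>a. (i * k + a) mod n) {..<k}"
  proof (rule inj_onI)
    fix a b assume ab: "a \<in> {..<k}" "b \<in> {..<k}" and "(i * k + a) mod n = (i * k + b) mod n"
    then have "[a = b] (mod n)" by (simp add: cong_def[symmetric] cong_add_lcancel_nat)
    then show "a = b" using ab assms by (simp add: cong_less_modulus_unique_nat)
  qed
  moreover have "{j. j < n \<and> cyclic_matrix n k $$ (i, j) = 1} = (\<lambda>a. (i * k + a) mod n) ` {..<k}"
    using assms by (auto simp: cyclic_matrix_eq_1_iff)
  ultimately show ?thesis by (simp add: card_image)
qed

lemma card_cyclic_matrix_column: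
  assumes "j < n" "k \<le> n"
  shows "card {i. i < n \<and> cyclic_matrix n k $$ (i, j) = 1} = k"
proof -
  have "{i. i < n \<and> cyclic_matrix n k $$ (i, j) = 1} = rider n k j ` {..<k}"
    using assms by (auto simp: cyclic_matrix_eq_1_iff_rider rider_less)
  then show ?thesis using inj_on_rider[OF assms(2)] by (simp add: card_image)
qed

lemma k_uniform_cyclic_matrix:
  assumes "k \<le> n"
  shows "k_uniform n k (cyclic_matrix n k)"
  unfolding k_uniform_def
  using assms cyclic_matrix_carrier card_cyclic_matrix_row card_cyclic_matrix_column
  by (auto simp: cyclic_matrix_def)

section \<open>Departure times and handovers\<close>

text \<open>The timetable in which nobody waits; what remains is to show that the bicycles can
  follow it.\<close>

definition departure :: "real \<Rightarrow> real \<Rightarrow> nat mat \<Rightarrow> nat \<Rightarrow> nat \<Rightarrow> real" where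
  "departure w v M i j = (\<Sum>l<j. stage_time w v M i l)"

lemma departure_Suc: "departure w v M i (Suc j) = departure w v M i j + stage_time w v M i j"
  by (simp add: departure_def)

lemma departure_eq_arrival: "departure w v M i j = arrival w v M (departure w v M) i j"
  by (cases j) (simp_all add: arrival_def departure_def)

lemma departure_nonneg:
  assumes "0 < w" "0 < v"
  shows "0 \<le> departure w v M i j"
  unfolding departure_def using assms by (intro sum_nonneg) (simp add: stage_time_def)

text \<open>Each cycled stage saves \<open>1 / w - 1 / v\<close> over walking, so comparing times at
  a post reduces to counting cycled stages.\<close>

lemma departure_eq_card:
  "departure w v M i j = real j / w - real (card {l. l < j \<and> M $$ (i, l) = 1}) * (1 / w - 1 / v)"
proof (induction j)
  case (Suc j)
  have "{l. l < Suc j \<and> M $$ (i, l) = 1} =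
      (if M $$ (i, j) = 1 then insert j {l. l < j \<and> M $$ (i, l) = 1}
       else {l. l < j \<and> M $$ (i, l) = 1})"
    by (auto simp: less_Suc_eq)
  then show ?case
    using Suc by (simp add: departure_Suc stage_time_def algebra_simps add_divide_distrib)
qed (simp add: departure_def)

lemma departure_mono_card:
  assumes "0 < w" "w < v"
    and "card {l. l < j \<and> M $$ (i', l) = 1} \<le> card {l. l < j \<and> M $$ (i, l) = 1}"
  shows "departure w v M i j \<le> departure w v M i' j"
  unfolding departure_eq_card
  using assms by (intro diff_left_mono mult_right_mono) (auto simp: frac_le)

lemma card_cycled_le:
  assumes "k \<le> n" "i < n" "j \<le> n"
  shows "card {l. l < j \<and> cyclic_matrix n k $$ (i, l) = 1} \<le> min j k"
proof -
  have "card {l. l < j \<and> cyclic_matrix n k $$ (i, l) = 1} \<le> card {..<j}"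
    by (intro card_mono) auto
  moreover have "card {l. l < j \<and> cyclic_matrix n k $$ (i, l) = 1}
      \<le> card {l. l < n \<and> cyclic_matrix n k $$ (i, l) = 1}"
    using assms by (intro card_mono) auto
  ultimately show ?thesis using assms by (simp add: card_cyclic_matrix_row)
qed

text \<open>Row \<open>i\<close> consists of the \<open>k\<close> positions just before
  \<open>Suc i * k\<close>. The last \<open>min j k\<close> of them belong to bicycle
  \<open>m\<close>, in the columns directly before \<open>j\<close>.\<close>

lemma card_cycled_at_handover:
  assumes "m < k" "i < n" "j \<le> n" and handover: "j + m * n = Suc i * k"
  shows "min j k \<le> card {l. l < j \<and> cyclic_matrix n k $$ (i, l) = 1}"
proof -
  have "rider n k l m = i" if "j - min j k \<le> l" "l < j" for l
    unfolding rider_def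
    using that handover by (intro div_nat_eqI) (auto simp: mult.commute)
  then have "{j - min j k..<j} \<subseteq> {l. l < j \<and> cyclic_matrix n k $$ (i, l) = 1}"
    using assms(1-3) by (fastforce simp: cyclic_matrix_eq_1_iff_rider)
  then have "card {j - min j k..<j} \<le> card {l. l < j \<and> cyclic_matrix n k $$ (i, l) = 1}"
    by (intro card_mono) auto
  then show ?thesis by simp
qed

lemma departure_rider_Suc:
  fixes w v :: real and n k :: nat
  defines "dep \<equiv> departure w v (cyclic_matrix n k)"
  assumes "k \<le> n" "m < k" "Suc j < n" "0 < w" "w < v"
  shows "dep (rider n k j m) j + 1 / v \<le> dep (rider n k (Suc j) m) (Suc j)"
proof -
  let ?i = "rider n k j m" and ?i' = "rider n k (Suc j) m"
  have less: "?i < n" "?i' < n" using assms by (auto intro: rider_less)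
  have "cyclic_matrix n k $$ (?i, j) = 1"
    using less assms by (auto simp: cyclic_matrix_eq_1_iff_rider)
  then have step: "dep ?i (Suc j) = dep ?i j + 1 / v"
    by (simp add: dep_def departure_Suc stage_time_def)
  have "dep ?i (Suc j) \<le> dep ?i' (Suc j)"
  proof (cases "?i' = ?i")
    case False
    \<comment> \<open>A quotient by \<open>k\<close> grows, by exactly one, only when a multiple of
      \<open>k\<close> is reached.\<close>
    then have "Suc (j + m * n) mod k = 0" "?i' = Suc ?i"
      by (auto simp: rider_def div_Suc split: if_splits)
    then have "Suc j + m * n = Suc ?i * k"
      by (metis add_Suc add.right_neutral div_mult_mod_eq rider_def)
    \<comment> \<open>The old rider has cycled at least \<open>min (Suc j) k\<close> stages, the new
      one at most that many.\<close>
    from card_cycled_at_handover[OF _ _ _ this] show ?thesis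
      unfolding dep_def using assms less
      by (intro departure_mono_card order_trans[OF card_cycled_le]) auto
  qed simp
  then show ?thesis by (simp add: step)
qed

section \<open>Motion of a single bicycle\<close>

text \<open>
  The position of a bicycle whose ride over stage \<open>j\<close> starts at time \<open>D j\<close>: the \<open>j\<close>-th summand is
  the part of stage \<open>j\<close> that it has covered by time \<open>t\<close>.
\<close>

definition track :: "real \<Rightarrow> nat \<Rightarrow> (nat \<Rightarrow> real) \<Rightarrow> real \<Rightarrow> real" where
  "track v n D t = (\<Sum>j<n. max 0 (min 1 (v * (t - D j))))"

lemma track_eq_0:
  assumes "0 < v" "\<And>j. j < n \<Longrightarrow> t \<le> D j"
  shows "track v n D t = 0"
proof -
  have "v * (t - D j) \<le> 0" if "j < n" for j
    using assms(1) assms(2)[OF that] by (simp add: mult_le_0_iff)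
  then show ?thesis unfolding track_def by (intro sum.neutral) (simp add: min.coboundedI2)
qed

text \<open>Rides do not overlap and follow the order of the stages, so summands of earlier stages
  are clipped to 1 and those of later stages to 0.\<close>

lemma track_riding:
  fixes D :: "nat \<Rightarrow> real"
  assumes "0 < v" and j: "j < n" and t: "D j \<le> t" "t \<le> D j + 1 / v"
    and D: "\<And>j j'. j < j' \<Longrightarrow> j' < n \<Longrightarrow> D j + 1 / v \<le> D j'"
  shows "track v n D t = real j + v * (t - D j)"
proof -
  have le1: "v * (t - D j) \<le> 1" "0 \<le> v * (t - D j)"
    using t \<open>0 < v\<close> by (auto simp: field_simps)
  have "track v n D t =
      (\<Sum>l<n. (if l < j then 1 else 0) + (if l = j then v * (t - D j) else 0))"
    unfolding track_def
  proof (rule sum.cong[OF refl])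
    fix l assume "l \<in> {..<n}"
    consider "l < j" | "l = j" | "j < l" by linarith
    then show "max 0 (min 1 (v * (t - D l))) =
        (if l < j then 1 else 0) + (if l = j then v * (t - D j) else 0)"
    proof cases
      case 1
      then have "1 / v \<le> t - D l" using D[of l j] t j by linarith
      then have "1 \<le> v * (t - D l)" using \<open>0 < v\<close> by (simp add: field_simps)
      then show ?thesis using 1 by simp
    next
      case 2
      then show ?thesis using le1 by simp
    next
      case 3
      then have "t - D l \<le> 0" using D[of j l] t \<open>l \<in> {..<n}\<close> by simp
      then have "v * (t - D l) \<le> 0" using \<open>0 < v\<close> by (simp add: mult_le_0_iff)
      then show ?thesis using 3 by simp
    qed
  qed
  also have "\<dots> = real j + v * (t - D j)"
  proof -
    have "{..<n} \<inter> {l. l < j} = {..<j}" using j by auto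
    then show ?thesis using j by (simp add: sum.distrib sum.If_cases)
  qed
  finally show ?thesis .
qed

lemma track_idle:
  fixes D :: "nat \<Rightarrow> real"
  assumes "0 < v" "t1 \<le> t2"
    and idle: "\<And>t j. t1 \<le> t \<Longrightarrow> t < t2 \<Longrightarrow> j < n \<Longrightarrow> \<not> (D j \<le> t \<and> t < D j + 1 / v)"
  shows "track v n D t2 = track v n D t1"
  unfolding track_def
proof (rule sum.cong[OF refl])
  fix j assume "j \<in> {..<n}"
  then have j: "j < n" by simp
  consider "t1 = t2" | "t2 \<le> D j" | "t1 < t2" "D j < t2" using assms(2) by linarith
  then show "max 0 (min 1 (v * (t2 - D j))) = max 0 (min 1 (v * (t1 - D j)))"
  proof cases
    case 2
    then have "v * (t2 - D j) \<le> 0" "v * (t1 - D j) \<le> 0"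
      using assms by (auto simp: mult_le_0_iff)
    then show ?thesis by simp
  next
    case 3
    \<comment> \<open>A ride starting after \<open>t1\<close> and before \<open>t2\<close> would
      violate idleness at its own start. Idleness at \<open>t1\<close> then shows that the ride is
      already over.\<close>
    have "D j \<le> t1" using idle[of "D j" j] 3 j \<open>0 < v\<close> by force
    then have "1 / v \<le> t1 - D j" using idle[of t1 j] 3 j by force
    then have "1 \<le> v * (t1 - D j)" "1 \<le> v * (t2 - D j)"
      using 3 \<open>0 < v\<close> mult_left_mono[of "1 / v" "t1 - D j" v]
        mult_left_mono[of "1 / v" "t2 - D j" v] by auto
    then show ?thesis by simp
  qed simp
qed

section \<open>Assembling the execution\<close>

text \<open>The bicycle is recovered from stage and traveller by inverting \<open>rider\<close>. For
  a traveller who walks the stage the inverse is an arbitrary value, which \<open>riding\<close>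
  ignores.\<close>

lemma execution_cyclic_matrix:
  fixes w v :: real and n k :: nat
  assumes "k \<le> n" "0 < w" "w < v"
  defines "M \<equiv> cyclic_matrix n k"
  defines "dep \<equiv> departure w v M"
  defines "D \<equiv> \<lambda>c j. dep (rider n k j c) j"
  shows "execution w v n k M dep (\<lambda>i j. inv_into {..<k} (rider n k j) i) (\<lambda>c. track v n (D c))"
proof -
  let ?bike = "\<lambda>i j. inv_into {..<k} (rider n k j) i"
  have v: "0 < v" using assms by simp
  have bike: "?bike i j < k \<and> rider n k j (?bike i j) = i"
    if "i < n" "j < n" "M $$ (i, j) = 1" for i j
  proof -
    have "i \<in> rider n k j ` {..<k}"
      using that by (auto simp: M_def cyclic_matrix_eq_1_iff_rider)
    from inv_into_into[OF this] f_inv_into_f[OF this] show ?thesis by simp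
  qed
  \<comment> \<open>This turns riding into a condition on the timetable \<open>D c\<close> of one
    bicycle, the form in which \<open>track_idle\<close> applies.\<close>
  have riding_iff: "riding v n M dep ?bike i j c t \<longleftrightarrow>
      j < n \<and> i = rider n k j c \<and> D c j \<le> t \<and> t < D c j + 1 / v" if "c < k" for i j c t
  proof
    assume "riding v n M dep ?bike i j c t"
    then show "j < n \<and> i = rider n k j c \<and> D c j \<le> t \<and> t < D c j + 1 / v"
      using bike[of i j] unfolding riding_def D_def by auto
  next
    assume *: "j < n \<and> i = rider n k j c \<and> D c j \<le> t \<and> t < D c j + 1 / v"
    then have "i < n" using that by (auto intro: rider_less)
    moreover have "M $$ (i, j) = 1"
      using * that \<open>i < n\<close> by (auto simp: M_def cyclic_matrix_eq_1_iff_rider)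
    moreover have "?bike i j = c"
      using * that inj_on_rider[OF assms(1)] by (simp add: inv_into_f_f)
    ultimately show "riding v n M dep ?bike i j c t"
      using * unfolding riding_def D_def by auto
  qed
  \<comment> \<open>Adjacent stages are covered by \<open>departure_rider_Suc\<close>; chaining
    works because a ride takes positive time.\<close>
  have D_less: "D c j + 1 / v \<le> D c j'" if "c < k" "j < j'" "j' < n" for c j j'
    using that(2,3)
  proof (induction j')
    case (Suc j')
    have step: "D c j' + 1 / v \<le> D c (Suc j')"
      unfolding D_def dep_def M_def
      using Suc.prems that assms by (intro departure_rider_Suc) auto
    have "0 < 1 / v" using v by simp
    show ?case
    proof (cases "j = j'")
      case False
      then have "D c j + 1 / v \<le> D c j'" using Suc by simp
      then show ?thesis using step \<open>0 < 1 / v\<close> by linarith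
    qed (use step in simp)
  qed simp
  have unique: "i = i' \<and> j = j'"
    if c: "c < k" and r: "riding v n M dep ?bike i j c t" "riding v n M dep ?bike i' j' c t"
    for c t i j i' j'
  proof -
    note r = r[unfolded riding_iff[OF c]]
    have "j = j'"
    proof (rule ccontr)
      assume "j \<noteq> j'"
      then consider "j < j'" | "j' < j" by linarith
      then show False using D_less[OF c, of j j'] D_less[OF c, of j' j] r by cases linarith+
    qed
    then show ?thesis using r by simp
  qed
  have at0: "track v n (D c) 0 = 0" for c
    using v assms by (intro track_eq_0) (auto simp: D_def dep_def departure_nonneg)
  have ride: "track v n (D (?bike i j)) t = real j + v * (t - dep i j)"
    if "i < n" "j < n" "M $$ (i, j) = 1" "t \<in> {dep i j..dep i j + 1 / v}" for i j t
    using track_riding[OF v, of j n "D (?bike i j)" t] that bike[OF that(1-3)] D_less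
    by (auto simp: D_def)
  have rest: "track v n (D c) t2 = track v n (D c) t1"
    if "c < k" "t1 \<le> t2" "\<forall>t\<in>{t1..<t2}. \<forall>i j. \<not> riding v n M dep ?bike i j c t" for c t1 t2
    using that riding_iff by (intro track_idle[OF v]) auto
  have arr: "dep i j = arrival w v M dep i j" for i j
    unfolding dep_def by (rule departure_eq_arrival)
  show ?thesis
    unfolding execution_def
  proof (intro conjI)
    show "\<forall>i<n. \<forall>j<n. M $$ (i, j) = 0 \<longrightarrow> dep i j = arrival w v M dep i j"
      using arr by blast
    show "\<forall>i<n. \<forall>j<n. M $$ (i, j) = 1 \<longrightarrow> dep i j \<ge> arrival w v M dep i j \<and> ?bike i j < k"
      using eq_refl[OF arr[symmetric]] bike by blast
    show "\<forall>c<k. track v n (D c) 0 = 0"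
      using at0 by blast
    show "\<forall>c<k. \<forall>t i j i' j'. riding v n M dep ?bike i j c t \<and> riding v n M dep ?bike i' j' c t
        \<longrightarrow> i = i' \<and> j = j'"
      using unique by blast
    show "\<forall>i<n. \<forall>j<n. M $$ (i, j) = 1 \<longrightarrow> (\<forall>t\<in>{dep i j..dep i j + 1 / v}.
        track v n (D (?bike i j)) t = real j + v * (t - dep i j))"
      using ride by blast
    show "\<forall>c<k. \<forall>t1 t2. 0 \<le> t1 \<and> t1 \<le> t2 \<and>
        (\<forall>t\<in>{t1..<t2}. \<forall>i j. \<not> riding v n M dep ?bike i j c t)
        \<longrightarrow> track v n (D c) t2 = track v n (D c) t1"
      using rest by blast
  qed
qed

theorem theorem4p2:
  fixes n k :: nat and w v :: real
  assumes "n \<ge> 1" and "k \<le> n" and "0 < w" and "w < v"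
  shows "k_uniform n k (cyclic_matrix n k) \<and> optimal w v n (cyclic_matrix n k)"
proof
  show uniform: "k_uniform n k (cyclic_matrix n k)"
    using assms by (intro k_uniform_cyclic_matrix)
  have "no_waiting w v n (cyclic_matrix n k) (departure w v (cyclic_matrix n k))"
    unfolding no_waiting_def by (intro allI impI departure_eq_arrival)
  then show "optimal w v n (cyclic_matrix n k)"
    unfolding optimal_def using uniform execution_cyclic_matrix[OF assms(2-4)] by blast
qed

end
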